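(* Let $0<\rho<1$ and let $N\ge2$ be even. Let $\mathbf{W}_N(\rho)$ be the AR(1) Karhunen--Loève transform (with some fixed choice of row signs). Then: (1) The map $x\mapsto\mathbf{W}_N(\rho)x$ can be computed with $N^2/2$ multiplications and $N^2/2$ additions. (2) There is a diagonal matrix $E$ with positive diagonal entries such that the map $x\mapsto E\,\mathbf{W}_N(\rho)x$ can be computed with $N^2/2-N$ multiplications. (3) In particular, for $N=8$, $x\mapsto\mathbf{W}_8(\rho)x$ can be computed with $32$ multiplications and $32$ additions, and $x\mapsto E\,\mathbf{W}_8(\rho)x$, for a suitable positive diagonal $E$, with $24$ multiplications and $32$ additions. (4) For $N=4$, $x\mapsto\mathbf{W}_4(\rho)x$ can be computed with $6$ multiplications and $10$ additions, and $x\mapsto E\,\mathbf{W}_4(\rho)x$, for a suitable positive diagonal $E$, with $4$ multiplications and $8$ additions.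
   Context: $\mathbf{R}_N(\rho)=[\rho^{|i-j|}]_{i,j=0}^{N-1}$ is the AR(1) covariance matrix. Its Karhunen--Loève transform (KLT) $\mathbf{W}_N(\rho)$ is the orthogonal matrix whose rows are the unit eigenvectors of $\mathbf{R}_N(\rho)$, ordered by decreasing eigenvalue (each row determined up to sign). Operation counts refer to linear straight-line programs with inputs $x_0,\dots,x_{N-1}$: each step either forms the sum or difference of two previously computed quantities (counted as one addition), multiplies a previously computed quantity by a fixed real constant depending only on $\rho$ (counted as one multiplication), or negates or copies a previously computed quantity (not counted). All constants are precomputed from $\rho$ at no cost. The outputs are the $N$ coordinates of the transformed vector. "Can be computed with $a$ multiplications and $b$ additions" means that such a program exists using at most these numbers of operations; where only multiplications are mentioned, the number of additions is unrestricted. *)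

theory Defs
  imports Complex_Main "Jordan_Normal_Form.Char_Poly"
begin

definition ar1_cov :: "nat \<Rightarrow> real \<Rightarrow> real mat" where
  "ar1_cov N \<rho> = mat N N (\<lambda>(i, j). \<rho> ^ nat \<bar>int i - int j\<bar>)"

(* Every admissible choice of row signs satisfies this predicate.  Simplicity of the
   spectrum is a property of the AR(1) matrix and is deliberately not assumed here,
   hence the non-strict ordering. *)
definition is_KLT :: "nat \<Rightarrow> real \<Rightarrow> real mat \<Rightarrow> bool" where
  "is_KLT N \<rho> W \<longleftrightarrow>
     W \<in> carrier_mat N N \<and> W * W\<^sup>T = 1\<^sub>m N \<and>
     (\<exists>ev :: nat \<Rightarrow> real.
        (\<forall>i<N. eigenvector (ar1_cov N \<rho>) (row W i) (ev i)) \<and>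
        (\<forall>i j. i \<le> j \<longrightarrow> j < N \<longrightarrow> ev j \<le> ev i))"

definition pos_diag_mat :: "nat \<Rightarrow> real mat \<Rightarrow> bool" where
  "pos_diag_mat N E \<longleftrightarrow> E \<in> carrier_mat N N \<and> diagonal_mat E \<and> (\<forall>i<N. 0 < E $$ (i, i))"

(* Linear straight-line programs.  Operands are positions in the list of all quantities
   available so far: the inputs occupy positions 0, ..., N - 1 and the k-th step (counted
   from 0) appends its result at position N + k. *)
datatype slp_step =
    Add nat nat
  | Sub nat nat
  | Scale real nat
  | Neg nat
  | Copy nat

fun operands :: "slp_step \<Rightarrow> nat set" where
  "operands (Add i j) = {i, j}"
| "operands (Sub i j) = {i, j}"
| "operands (Scale c i) = {i}"
| "operands (Neg i) = {i}"
| "operands (Copy i) = {i}"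

fun step_value :: "real list \<Rightarrow> slp_step \<Rightarrow> real" where
  "step_value vs (Add i j) = vs ! i + vs ! j"
| "step_value vs (Sub i j) = vs ! i - vs ! j"
| "step_value vs (Scale c i) = c * vs ! i"
| "step_value vs (Neg i) = - (vs ! i)"
| "step_value vs (Copy i) = vs ! i"

fun is_addition :: "slp_step \<Rightarrow> bool" where
  "is_addition (Add i j) = True"
| "is_addition (Sub i j) = True"
| "is_addition _ = False"

fun is_multiplication :: "slp_step \<Rightarrow> bool" where
  "is_multiplication (Scale c i) = True"
| "is_multiplication _ = False"

definition num_additions :: "slp_step list \<Rightarrow> nat" where
  "num_additions p = length (filter is_addition p)"

definition num_multiplications :: "slp_step list \<Rightarrow> nat" where
  "num_multiplications p = length (filter is_multiplication p)"

definition slp_well_formed :: "nat \<Rightarrow> slp_step list \<Rightarrow> bool" where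
  "slp_well_formed N p \<longleftrightarrow> (\<forall>k<length p. \<forall>i\<in>operands (p ! k). i < N + k)"

definition slp_run :: "slp_step list \<Rightarrow> real list \<Rightarrow> real list" where
  "slp_run p xs = foldl (\<lambda>vs s. vs @ [step_value vs s]) xs p"

(* outs ! i is the position of the quantity that is returned as i-th output coordinate. *)
definition slp_computes ::
  "nat \<Rightarrow> slp_step list \<Rightarrow> nat list \<Rightarrow> (real vec \<Rightarrow> real vec) \<Rightarrow> bool" where
  "slp_computes N p outs f \<longleftrightarrow>
     slp_well_formed N p \<and> length outs = N \<and> (\<forall>k\<in>set outs. k < N + length p) \<and>
     (\<forall>x\<in>carrier_vec N.
        vec_of_list (map (\<lambda>k. slp_run p (list_of_vec x) ! k) outs) = f x)"

definition computable_with ::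
  "nat \<Rightarrow> (real vec \<Rightarrow> real vec) \<Rightarrow> nat \<Rightarrow> nat \<Rightarrow> bool" where
  "computable_with N f a b \<longleftrightarrow>
     (\<exists>p outs. slp_computes N p outs f \<and>
        num_multiplications p \<le> a \<and> num_additions p \<le> b)"

definition computable_with_mults :: "nat \<Rightarrow> (real vec \<Rightarrow> real vec) \<Rightarrow> nat \<Rightarrow> bool" where
  "computable_with_mults N f a \<longleftrightarrow>
     (\<exists>p outs. slp_computes N p outs f \<and> num_multiplications p \<le> a)"

end

theory Submission
  imports Defs
begin

text \<open>Since \<open>0 < \<rho> < 1\<close>, an eigenvector of the AR(1) matrix is determined by its first entry,
  so every eigenspace is a line. The matrix commutes with index reversal, hence every
  eigenvector is symmetric or antisymmetric. After the \<open>N\<close> butterflies \<open>x\<^sub>k \<plusminus> x\<^sub>N\<^sub>-\<^sub>1\<^sub>-\<^sub>k\<close> each row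
  costs an inner product of length \<open>N/2\<close>, and dividing a row by the modulus of its first
  entry makes one of the coefficients \<open>\<plusminus>1\<close>. For \<open>N = 4\<close> the trace of the reversal shows that
  two rows are symmetric and two antisymmetric; either pair acts on its two butterflies as a
  multiple of an orthogonal \<open>2 \<times> 2\<close> matrix, which costs only three multiplications.\<close>

section \<open>Eigenvectors of the AR(1) matrix\<close>

text \<open>From row \<open>i\<close> to row \<open>Suc i\<close> the exponent grows by one for
  \<open>j \<le> i\<close> and drops by one for \<open>j > i\<close>. Multiplying by
  \<open>\<rho>\<close> is therefore right for the former, while the latter leave
  \<open>\<rho>^d - \<rho>^(d+2) = (1 - \<rho>^2) * \<rho>^d\<close> with
  \<open>d = j - Suc i\<close>.\<close>

lemma ar1_sum_Suc:
  fixes \<rho> :: real and f :: "nat \<Rightarrow> real"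
  shows "(\<Sum>j<N. \<rho> ^ nat \<bar>int (Suc i) - int j\<bar> * f j) =
    \<rho> * (\<Sum>j<N. \<rho> ^ nat \<bar>int i - int j\<bar> * f j) + (1 - \<rho>^2) * (\<Sum>j=Suc i..<N. \<rho> ^ (j - Suc i) * f j)"
proof -
  have 1: "(\<Sum>j=Suc i..<N. \<rho> ^ (j - Suc i) * f j) =
      (\<Sum>j<N. if Suc i \<le> j then \<rho> ^ (j - Suc i) * f j else 0)"
  proof -
    have "{Suc i..<N} = {j\<in>{..<N}. Suc i \<le> j}" by auto
    then show ?thesis by (simp add: sum.inter_filter[symmetric])
  qed
  have "\<rho> ^ nat \<bar>int (Suc i) - int j\<bar> * f j =
     \<rho> * (\<rho> ^ nat \<bar>int i - int j\<bar> * f j) + (1 - \<rho>^2) * (if Suc i \<le> j then \<rho> ^ (j - Suc i) * f j else 0)" for j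
  proof (cases "Suc i \<le> j")
    case True
    then obtain d where d: "j = Suc i + d" using le_Suc_ex by blast
    have "nat \<bar>int (Suc i) - int j\<bar> = d" "nat \<bar>int i - int j\<bar> = Suc d" "j - Suc i = d"
      using d by auto
    then show ?thesis using True by (simp add: algebra_simps power2_eq_square)
  next
    case False
    then have "nat \<bar>int (Suc i) - int j\<bar> = Suc (nat \<bar>int i - int j\<bar>)" by auto
    then show ?thesis using False by simp
  qed
  then show ?thesis unfolding 1 by (simp only: sum_distrib_left sum.distrib)
qed

text \<open>The eigenvalue equations become a two-term recursion for \<open>f\<close> and its
  geometric tail sums \<open>C\<close>. Row 0 reads \<open>C 0 = ev * f 0 = 0\<close>, and this zero
  start propagates. Applied to a combination of two eigenvectors for the same \<open>ev\<close>, the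
  lemma shows that they are proportional.\<close>

lemma ar1_eigen_eq_0:
  fixes \<rho> ev :: real and f :: "nat \<Rightarrow> real"
  assumes \<rho>: "0 < \<rho>" "\<rho> < 1"
    and eig: "\<And>i. i < N \<Longrightarrow> (\<Sum>j<N. \<rho> ^ nat \<bar>int i - int j\<bar> * f j) = ev * f i"
    and f0: "f 0 = 0"
    and "i < N"
  shows "f i = 0"
proof -
  define C where "C i = (\<Sum>j=i..<N. \<rho> ^ (j - i) * f j)" for i
  have C_rec: "C i = f i + \<rho> * C (Suc i)" if "i < N" for i
  proof -
    have "C i = f i + (\<Sum>j=Suc i..<N. \<rho> ^ (j - i) * f j)"
      using that unfolding C_def by (simp add: sum.atLeast_Suc_lessThan)
    also have "(\<Sum>j=Suc i..<N. \<rho> ^ (j - i) * f j) = \<rho> * C (Suc i)"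
      unfolding C_def sum_distrib_left by (rule sum.cong) (auto simp: Suc_diff_Suc[symmetric])
    finally show ?thesis .
  qed
  have step: "ev * f (Suc i) = \<rho> * (ev * f i) + (1 - \<rho>^2) * C (Suc i)" if "Suc i < N" for i
    using ar1_sum_Suc[where N = N and \<rho> = \<rho> and i = i and f = f] eig[of i] eig[of "Suc i"] that by (simp add: C_def)
  have \<rho>2: "1 - \<rho>^2 \<noteq> 0"
    using \<rho> power2_eq_1_iff[of \<rho>] by auto
  have C0: "C i = 0 \<and> ev * f i = 0" if "i < N" for i
    using that
  proof (induction i)
    case 0
    have "C 0 = (\<Sum>j<N. \<rho> ^ nat \<bar>int 0 - int j\<bar> * f j)"
      unfolding C_def by (simp add: atLeast0LessThan)
    then show ?case using eig[OF 0] f0 by simp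
  next
    case (Suc i)
    then have IH: "C i = 0" "ev * f i = 0" by auto
    show ?case
    \<comment> \<open>For \<open>ev = 0\<close> the row recursion leaves only
      \<open>(1 - \<rho>^2) * C (Suc i) = 0\<close>. Otherwise \<open>f i = 0\<close>, and
      \<open>C_rec\<close> gives \<open>\<rho> * C (Suc i) = 0\<close>.\<close>
    proof (cases "ev = 0")
      case True
      then show ?thesis using step[OF Suc.prems] \<rho>2 by simp
    next
      case False
      then have "C (Suc i) = 0" using IH C_rec[of i] Suc.prems \<rho> by simp
      then show ?thesis using step[OF Suc.prems] IH by simp
    qed
  qed
  \<comment> \<open>At the last index the tail is the empty sum, so
    \<open>f i = C i - \<rho> * C (Suc i)\<close> vanishes there too.\<close>
  have "C (Suc i) = 0"
  proof (cases "Suc i < N")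
    case True
    then show ?thesis using C0 by blast
  next
    case False
    then show ?thesis by (simp add: C_def)
  qed
  then show ?thesis using C_rec[OF \<open>i < N\<close>] C0[OF \<open>i < N\<close>] by simp
qed

text \<open>Since \<open>\<bar>i - j\<bar>\<close> does not change when both indices are reversed,
  the reversed vector \<open>r\<close> satisfies the same eigenvalue equations and is a multiple of
  \<open>v\<close>. Reversing twice is the identity, so the factor squares to 1.\<close>

lemma ar1_eigenvector_reversal:
  fixes \<rho> ev :: real
  assumes \<rho>: "0 < \<rho>" "\<rho> < 1" and eig: "eigenvector (ar1_cov N \<rho>) v ev"
  shows "v $ 0 \<noteq> 0" and "\<exists>e\<in>{1, -1}. \<forall>k<N. v $ (N - 1 - k) = e * v $ k"
proof -
  have v: "v \<in> carrier_vec N" "v \<noteq> 0\<^sub>v N" and Rv: "ar1_cov N \<rho> *\<^sub>v v = ev \<cdot>\<^sub>v v"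
    using eig by (auto simp: eigenvector_def ar1_cov_def)
  have sum_v: "(\<Sum>j<N. \<rho> ^ nat \<bar>int i - int j\<bar> * v $ j) = ev * v $ i" if "i < N" for i
  proof -
    have "(ar1_cov N \<rho> *\<^sub>v v) $ i = (\<Sum>j<N. \<rho> ^ nat \<bar>int i - int j\<bar> * v $ j)"
      using that v by (simp add: ar1_cov_def scalar_prod_def atLeast0LessThan)
    then show ?thesis using Rv v that by simp
  qed
  show v0: "v $ 0 \<noteq> 0"
  proof
    assume "v $ 0 = 0"
    then have "\<forall>i<N. v $ i = 0"
      using ar1_eigen_eq_0[OF \<rho>, of N "\<lambda>j. v $ j"] sum_v by blast
    then show False using v by (auto simp: vec_eq_iff)
  qed
  define r where "r k = v $ (N - 1 - k)" for k
  have sum_r: "(\<Sum>j<N. \<rho> ^ nat \<bar>int i - int j\<bar> * r j) = ev * r i" if "i < N" for i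
  proof -
    have "(\<Sum>j<N. \<rho> ^ nat \<bar>int i - int j\<bar> * r j) =
        (\<Sum>j<N. \<rho> ^ nat \<bar>int i - int (N - Suc j)\<bar> * r (N - Suc j))"
      by (rule sum.nat_diff_reindex[symmetric])
    also have "\<dots> = (\<Sum>j<N. \<rho> ^ nat \<bar>int (N - 1 - i) - int j\<bar> * v $ j)"
    proof (rule sum.cong[OF refl])
      fix j assume "j \<in> {..<N}"
      then have "nat \<bar>int i - int (N - Suc j)\<bar> = nat \<bar>int (N - 1 - i) - int j\<bar>"
        and "N - 1 - (N - Suc j) = j" using that by auto
      then show "\<rho> ^ nat \<bar>int i - int (N - Suc j)\<bar> * r (N - Suc j) =
          \<rho> ^ nat \<bar>int (N - 1 - i) - int j\<bar> * v $ j" by (simp only: r_def)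
    qed
    also have "\<dots> = ev * r i" using sum_v[of "N - 1 - i"] that by (simp add: r_def)
    finally show ?thesis .
  qed
  \<comment> \<open>This combination of \<open>r\<close> and \<open>v\<close> is chosen to vanish at
    index 0.\<close>
  define f where "f j = v $ 0 * r j - r 0 * v $ j" for j
  have "f i = 0" if "i < N" for i
  proof (rule ar1_eigen_eq_0[OF \<rho> _ _ that])
    fix i assume i: "i < N"
    have "(\<Sum>j<N. \<rho> ^ nat \<bar>int i - int j\<bar> * f j) =
       v $ 0 * (\<Sum>j<N. \<rho> ^ nat \<bar>int i - int j\<bar> * r j) - r 0 * (\<Sum>j<N. \<rho> ^ nat \<bar>int i - int j\<bar> * v $ j)"
      by (simp add: f_def sum_distrib_left sum_subtractf algebra_simps)
    also have "\<dots> = ev * f i" using sum_v[OF i] sum_r[OF i] by (simp add: f_def algebra_simps)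
    finally show "(\<Sum>j<N. \<rho> ^ nat \<bar>int i - int j\<bar> * f j) = ev * f i" .
  qed (simp add: f_def)
  then have r_eq: "r k = (r 0 / v $ 0) * v $ k" if "k < N" for k
    using v0 that by (simp add: f_def field_simps)
  have N: "0 < N" using v by (cases N) auto
  \<comment> \<open>Proportionality at the last index links \<open>v $ 0\<close> and
    \<open>r 0\<close> a second time, which fixes the square of the ratio.\<close>
  have "r (N - 1) = v $ 0" using N by (simp add: r_def)
  moreover have "r (N - 1) = (r 0 / v $ 0) * r 0" using r_eq[of "N - 1"] N by (simp add: r_def)
  ultimately have "r 0 * r 0 = v $ 0 * v $ 0" using v0 by (simp add: field_simps)
  then have "(r 0 / v $ 0)^2 = 1" using v0 by (simp add: power_divide power2_eq_square)
  then have "r 0 / v $ 0 \<in> {1, -1}" by (simp add: power2_eq_1_iff)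
  then show "\<exists>e\<in>{1, -1}. \<forall>k<N. v $ (N - 1 - k) = e * v $ k"
    using r_eq unfolding r_def by blast
qed

section \<open>Straight-line programs\<close>

text \<open>Programs are described by the set of functionals they make available together, without
  positions. Computed quantities stay available, so sharing intermediate results is membership in
  \<open>F\<close>.\<close>

definition slp_reaches :: "nat \<Rightarrow> (real vec \<Rightarrow> real) set \<Rightarrow> nat \<Rightarrow> nat \<Rightarrow> bool" where
  "slp_reaches N F a b \<longleftrightarrow>
     (\<exists>p. slp_well_formed N p \<and> num_multiplications p \<le> a \<and> num_additions p \<le> b \<and>
        (\<forall>f\<in>F. \<exists>k < N + length p. \<forall>x\<in>carrier_vec N. slp_run p (list_of_vec x) ! k = f x))"

lemma slp_run_snoc: "slp_run (p @ [s]) xs = slp_run p xs @ [step_value (slp_run p xs) s]"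
  by (simp add: slp_run_def)

lemma length_slp_run [simp]: "length (slp_run p xs) = length xs + length p"
  by (induction p rule: rev_induct) (simp_all add: slp_run_def)

lemma slp_well_formed_snoc:
  "slp_well_formed N (p @ [s]) \<longleftrightarrow> slp_well_formed N p \<and> (\<forall>i\<in>operands s. i < N + length p)"
  by (auto simp: slp_well_formed_def nth_append less_Suc_eq)

lemma slp_reaches_mono:
  "slp_reaches N F a b \<Longrightarrow> G \<subseteq> F \<Longrightarrow> a \<le> a' \<Longrightarrow> b \<le> b' \<Longrightarrow> slp_reaches N G a' b'"
  unfolding slp_reaches_def by (elim exE conjE, intro exI conjI) (assumption | rule le_trans | blast)+

lemma slp_reaches_inputs: "slp_reaches N ((\<lambda>i x. x $ i) ` {..<N}) 0 0"
  unfolding slp_reaches_def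
proof (intro exI[of _ "[]"] conjI ballI)
  fix f :: "real vec \<Rightarrow> real"
  assume "f \<in> (\<lambda>i x. x $ i) ` {..<N}"
  then show "\<exists>k < N + length []. \<forall>x\<in>carrier_vec N. slp_run [] (list_of_vec x) ! k = f x"
    by (auto simp: slp_run_def list_of_vec_index)
qed (simp_all add: slp_well_formed_def num_multiplications_def num_additions_def)

text \<open>The appended result sits at position \<open>N + length p\<close>, and all earlier
  positions keep their values. The cost rules for the single operations are instances.\<close>

lemma slp_reaches_snoc:
  assumes wf: "slp_well_formed N p" and "num_multiplications p \<le> a" "num_additions p \<le> b"
    and F: "\<forall>f\<in>F. \<exists>k < N + length p. \<forall>x\<in>carrier_vec N. slp_run p (list_of_vec x) ! k = f x"
    and s: "\<forall>i\<in>operands s. i < N + length p"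
    and h: "\<forall>x\<in>carrier_vec N. step_value (slp_run p (list_of_vec x)) s = h x"
  shows "slp_reaches N (insert h F) (if is_multiplication s then Suc a else a)
    (if is_addition s then Suc b else b)"
  unfolding slp_reaches_def
proof (intro exI[of _ "p @ [s]"] conjI ballI)
  show "slp_well_formed N (p @ [s])" using wf s by (simp add: slp_well_formed_snoc)
  show "num_multiplications (p @ [s]) \<le> (if is_multiplication s then Suc a else a)"
    "num_additions (p @ [s]) \<le> (if is_addition s then Suc b else b)"
    using assms by (auto simp: num_multiplications_def num_additions_def)
  fix f assume "f \<in> insert h F"
  then consider "f = h" | "f \<in> F" by blast
  then show "\<exists>k < N + length (p @ [s]). \<forall>x\<in>carrier_vec N. slp_run (p @ [s]) (list_of_vec x) ! k = f x"
  proof cases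
    case 1
    then show ?thesis using h
      by (intro exI[of _ "N + length p"]) (auto simp: slp_run_snoc nth_append)
  next
    case 2
    then obtain k where "k < N + length p" "\<forall>x\<in>carrier_vec N. slp_run p (list_of_vec x) ! k = f x"
      using F by blast
    then show ?thesis
      by (intro exI[of _ k]) (auto simp: slp_run_snoc nth_append)
  qed
qed

lemma slp_reaches_unary:
  assumes "slp_reaches N F a b" and f: "f \<in> F"
  shows slp_reaches_scale: "slp_reaches N (insert (\<lambda>x. c * f x) F) (Suc a) b"
    and slp_reaches_neg: "slp_reaches N (insert (\<lambda>x. - f x) F) a b"
proof -
  obtain p where p: "slp_well_formed N p" "num_multiplications p \<le> a" "num_additions p \<le> b"
    "\<forall>f\<in>F. \<exists>k < N + length p. \<forall>x\<in>carrier_vec N. slp_run p (list_of_vec x) ! k = f x"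
    using assms(1) unfolding slp_reaches_def by blast
  obtain i where "i < N + length p" "\<forall>x\<in>carrier_vec N. slp_run p (list_of_vec x) ! i = f x"
    using p(4) f by blast
  then show "slp_reaches N (insert (\<lambda>x. c * f x) F) (Suc a) b"
    "slp_reaches N (insert (\<lambda>x. - f x) F) a b"
    using slp_reaches_snoc[OF p, of "Scale c i"] slp_reaches_snoc[OF p, of "Neg i"] by simp_all
qed

lemma slp_reaches_binary:
  assumes "slp_reaches N F a b" and f: "f \<in> F" and g: "g \<in> F"
  shows slp_reaches_add: "slp_reaches N (insert (\<lambda>x. f x + g x) F) a (Suc b)"
    and slp_reaches_sub: "slp_reaches N (insert (\<lambda>x. f x - g x) F) a (Suc b)"
proof -
  obtain p where p: "slp_well_formed N p" "num_multiplications p \<le> a" "num_additions p \<le> b"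
    "\<forall>f\<in>F. \<exists>k < N + length p. \<forall>x\<in>carrier_vec N. slp_run p (list_of_vec x) ! k = f x"
    using assms(1) unfolding slp_reaches_def by blast
  obtain i j where "i < N + length p" "\<forall>x\<in>carrier_vec N. slp_run p (list_of_vec x) ! i = f x"
    and "j < N + length p" "\<forall>x\<in>carrier_vec N. slp_run p (list_of_vec x) ! j = g x"
    using p(4) f g by meson
  then show "slp_reaches N (insert (\<lambda>x. f x + g x) F) a (Suc b)"
    "slp_reaches N (insert (\<lambda>x. f x - g x) F) a (Suc b)"
    using slp_reaches_snoc[OF p, of "Add i j"] slp_reaches_snoc[OF p, of "Sub i j"] by simp_all
qed

text \<open>A factor -1 is a free negation, and a factor 1 needs no step at all.\<close>

lemma slp_reaches_sign:
  assumes "slp_reaches N F a b" "f \<in> F" "c \<in> {1, -1}"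
  shows "slp_reaches N (insert (\<lambda>x. c * f x) F) a b"
  using assms slp_reaches_neg[OF assms(1,2)] by (auto simp: insert_absorb)

text \<open>Each term costs one product and one addition onto an accumulator that starts at the
  available quantity \<open>h\<close>.\<close>

lemma slp_reaches_add_sum:
  assumes "slp_reaches N F a b" "h \<in> F" and fin: "finite S" and "u ` S \<subseteq> F"
  shows "slp_reaches N (insert (\<lambda>x. h x + (\<Sum>k\<in>S. c k * u k x)) F) (a + card S) (b + card S)"
  using fin assms(4)
proof (induction S rule: finite_induct)
  case empty
  then show ?case using assms by (simp add: insert_absorb)
next
  case (insert k S)
  define h' where "h' x = h x + (\<Sum>k\<in>S. c k * u k x)" for x
  define t where "t x = c k * u k x" for x
  have "slp_reaches N (insert h' F) (a + card S) (b + card S)"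
    unfolding h'_def using insert by auto
  then have "slp_reaches N (insert t (insert h' F)) (Suc (a + card S)) (b + card S)"
    unfolding t_def by (rule slp_reaches_scale) (use insert.prems in auto)
  then have "slp_reaches N (insert (\<lambda>x. h' x + t x) (insert t (insert h' F)))
      (Suc (a + card S)) (Suc (b + card S))"
    by (rule slp_reaches_add) auto
  moreover have "(\<lambda>x. h' x + t x) = (\<lambda>x. h x + (\<Sum>k\<in>insert k S. c k * u k x))"
    using insert.hyps by (simp add: h'_def t_def fun_eq_iff)
  ultimately show ?case
    using insert.hyps by (auto elim: slp_reaches_mono)
qed

text \<open>The first product starts the accumulator, which saves one addition. If its coefficient
  is 1 or -1, it costs no multiplication either.\<close>

lemma slp_reaches_dot:
  assumes "slp_reaches N F a b" and u: "u ` {..<m} \<subseteq> F" and m: "0 < m"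
  shows "slp_reaches N (insert (\<lambda>x. \<Sum>k<m. c k * u k x) F) (a + m) (b + (m - 1))"
    and "c 0 \<in> {1, -1} \<Longrightarrow>
      slp_reaches N (insert (\<lambda>x. \<Sum>k<m. c k * u k x) F) (a + (m - 1)) (b + (m - 1))"
proof -
  define h where "h x = c 0 * u 0 x" for x
  have u0: "u 0 \<in> F" using u m by auto
  have split: "(\<lambda>x. \<Sum>k<m. c k * u k x) = (\<lambda>x. h x + (\<Sum>k=1..<m. c k * u k x))"
    using m by (simp add: h_def fun_eq_iff atLeast0LessThan[symmetric] sum.atLeast_Suc_lessThan)
  have *: "slp_reaches N (insert (\<lambda>x. \<Sum>k<m. c k * u k x) F) (a' + (m - 1)) (b + (m - 1))"
    if "slp_reaches N (insert h F) a' b" for a'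
  proof -
    have "u ` {1..<m} \<subseteq> insert h F"
      by (rule subset_insertI2, rule subset_trans[OF image_mono u]) auto
    from slp_reaches_add_sum[OF that insertI1 _ this, of c] show ?thesis
      unfolding split by (auto elim!: slp_reaches_mono)
  qed
  show "slp_reaches N (insert (\<lambda>x. \<Sum>k<m. c k * u k x) F) (a + m) (b + (m - 1))"
    using *[OF slp_reaches_scale[OF assms(1) u0, of "c 0", folded h_def]] m by simp
  show "slp_reaches N (insert (\<lambda>x. \<Sum>k<m. c k * u k x) F) (a + (m - 1)) (b + (m - 1))"
    if "c 0 \<in> {1, -1}"
    using *[OF slp_reaches_sign[OF assms(1) u0 that, folded h_def]] .
qed

text \<open>The step is required for every \<open>G\<close> above \<open>F\<close> and for all
  counts, because the available set and the costs grow as the family is computed member by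
  member.\<close>

lemma slp_reaches_family:
  assumes "slp_reaches N F a b" and "finite I"
    and step: "\<And>i G a b. i \<in> I \<Longrightarrow> F \<subseteq> G \<Longrightarrow> slp_reaches N G a b \<Longrightarrow>
      slp_reaches N (insert (h i) G) (a + m) (b + n)"
  shows "slp_reaches N (F \<union> h ` I) (a + card I * m) (b + card I * n)"
  using assms(2) step
proof (induction I rule: finite_induct)
  case empty
  then show ?case using assms(1) by simp
next
  case (insert i I)
  have "slp_reaches N (F \<union> h ` I) (a + card I * m) (b + card I * n)"
    using insert by blast
  then have "slp_reaches N (insert (h i) (F \<union> h ` I)) (a + card I * m + m) (b + card I * n + n)"
    by (intro insert.prems) auto
  then show ?case using insert.hyps by (simp add: algebra_simps)
qed

lemma computable_with_if_slp_reaches: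
  fixes f :: "real vec \<Rightarrow> real vec"
  assumes "slp_reaches N F a b"
    and f: "\<And>x. x \<in> carrier_vec N \<Longrightarrow> f x \<in> carrier_vec N"
    and F: "\<And>i. i < N \<Longrightarrow> \<exists>g\<in>F. \<forall>x\<in>carrier_vec N. g x = f x $ i"
  shows "computable_with N f a b"
proof -
  obtain p where p: "slp_well_formed N p" "num_multiplications p \<le> a" "num_additions p \<le> b"
    "\<forall>f\<in>F. \<exists>k < N + length p. \<forall>x\<in>carrier_vec N. slp_run p (list_of_vec x) ! k = f x"
    using assms(1) unfolding slp_reaches_def by blast
  have "\<exists>k < N + length p. \<forall>x\<in>carrier_vec N. slp_run p (list_of_vec x) ! k = f x $ i" if "i < N" for i
    using F[OF that] p(4) by fastforce
  then obtain out where out: "\<And>i. i < N \<Longrightarrow> out i < N + length p"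
    "\<And>i x. i < N \<Longrightarrow> x \<in> carrier_vec N \<Longrightarrow> slp_run p (list_of_vec x) ! out i = f x $ i"
    by metis
  have "slp_computes N p (map out [0..<N]) f"
    unfolding slp_computes_def
  proof (intro conjI ballI)
    fix x :: "real vec" assume x: "x \<in> carrier_vec N"
    show "vec_of_list (map (\<lambda>k. slp_run p (list_of_vec x) ! k) (map out [0..<N])) = f x"
      using x f[OF x] out(2)[OF _ x] by (intro eq_vecI) (auto simp: vec_of_list_index)
  qed (use p out in auto)
  then show ?thesis using p unfolding computable_with_def by blast
qed

section \<open>Matrices with symmetric and antisymmetric rows\<close>

definition butterfly :: "nat \<Rightarrow> real \<Rightarrow> nat \<Rightarrow> real vec \<Rightarrow> real" where
  "butterfly N e k x = x $ k + e * x $ (N - 1 - k)"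

definition butterflies :: "nat \<Rightarrow> (real vec \<Rightarrow> real) set" where
  "butterflies N = (\<lambda>(e, k). butterfly N e k) ` ({1, -1} \<times> {..<N div 2})"

lemma butterfly_in_butterflies:
  "e \<in> {1, -1} \<Longrightarrow> k < N div 2 \<Longrightarrow> butterfly N e k \<in> butterflies N"
  unfolding butterflies_def by (rule rev_image_eqI[of "(e, k)"]) auto

text \<open>Each of the \<open>2 * (N div 2) = N\<close> butterflies is one sum
  (\<open>e = 1\<close>) or one difference (\<open>e = -1\<close>) of inputs.\<close>

lemma slp_reaches_butterflies:
  assumes "even N"
  shows "slp_reaches N (butterflies N) 0 N"
proof -
  let ?X = "(\<lambda>i x. x $ i) ` {..<N} :: (real vec \<Rightarrow> real) set"
  have "slp_reaches N (?X \<union> (\<lambda>(e, k). butterfly N e k) ` ({1, -1} \<times> {..<N div 2}))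
      (0 + card ({1, -1 :: real} \<times> {..<N div 2}) * 0) (0 + card ({1, -1 :: real} \<times> {..<N div 2}) * 1)"
  proof (rule slp_reaches_family[OF slp_reaches_inputs])
    fix i :: "real \<times> nat" and G a b
    assume i: "i \<in> {1, -1} \<times> {..<N div 2}" and G: "?X \<subseteq> G" "slp_reaches N G a b"
    obtain e k where ek: "i = (e, k)" "e \<in> {1, -1}" "k < N div 2" using i by auto
    then have *: "(\<lambda>x. x $ k) \<in> G" "(\<lambda>x. x $ (N - Suc k)) \<in> G" using G(1) by auto
    have "slp_reaches N (insert (butterfly N e k) G) a (Suc b)"
      using ek(2) slp_reaches_add[OF G(2) *] slp_reaches_sub[OF G(2) *]
      by (auto simp: butterfly_def[abs_def])
    then show "slp_reaches N (insert ((\<lambda>(e, k). butterfly N e k) i) G) (a + 0) (b + 1)"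
      by (simp add: ek)
  qed auto
  then show ?thesis
    using assms unfolding butterflies_def
    by (auto simp: card_cartesian_product elim: slp_reaches_mono)
qed

text \<open>Orthogonality is left out so that the property survives a rescaling of the rows. The
  signs \<open>e\<close> are explicit because row \<open>i\<close> uses only the butterflies of sign
  \<open>e i\<close>.\<close>

definition reversal_rows :: "nat \<Rightarrow> real mat \<Rightarrow> (nat \<Rightarrow> real) \<Rightarrow> bool" where
  "reversal_rows N W e \<longleftrightarrow> W \<in> carrier_mat N N \<and>
     (\<forall>i<N. e i \<in> {1, -1} \<and> (\<forall>k<N. W $$ (i, N - 1 - k) = e i * W $$ (i, k)))"

lemma sum_fold_even:
  fixes g :: "nat \<Rightarrow> 'a :: comm_monoid_add"
  assumes "even N"
  shows "(\<Sum>k<N. g k) = (\<Sum>k<N div 2. g k + g (N - 1 - k))"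
proof -
  obtain m where m: "N = 2 * m" using assms by (elim evenE)
  have "(\<Sum>k<N. g k) = (\<Sum>k<m. g k) + (\<Sum>k=m..<2*m. g k)"
    using sum.atLeastLessThan_concat[of 0 m "2*m" g] m by (simp add: atLeast0LessThan)
  also have "(\<Sum>k=m..<2*m. g k) = (\<Sum>k<m. g (N - 1 - k))"
    by (rule sum.reindex_bij_witness[of _ "\<lambda>k. N - 1 - k" "\<lambda>k. N - 1 - k"]) (auto simp: m)
  finally show ?thesis by (simp add: m sum.distrib)
qed

lemma reversal_rows_mult_vec:
  assumes W: "reversal_rows N W e" and "even N" "i < N" "x \<in> carrier_vec N"
  shows "(W *\<^sub>v x) $ i = (\<Sum>k<N div 2. W $$ (i, k) * butterfly N (e i) k x)"
proof -
  have "(W *\<^sub>v x) $ i = (\<Sum>k<N. W $$ (i, k) * x $ k)"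
    using assms by (auto simp: reversal_rows_def scalar_prod_def atLeast0LessThan)
  also have "\<dots> = (\<Sum>k<N div 2. W $$ (i, k) * butterfly N (e i) k x)"
    unfolding sum_fold_even[OF \<open>even N\<close>]
  proof (rule sum.cong[OF refl])
    fix k assume "k \<in> {..<N div 2}"
    then have "W $$ (i, N - 1 - k) = e i * W $$ (i, k)"
      using W \<open>i < N\<close> by (auto simp: reversal_rows_def)
    then show "W $$ (i, k) * x $ k + W $$ (i, N - 1 - k) * x $ (N - 1 - k) =
        W $$ (i, k) * butterfly N (e i) k x"
      unfolding butterfly_def by (simp only: algebra_simps)
  qed
  finally show ?thesis .
qed

text \<open>The \<open>N\<close> butterflies and \<open>N\<close> inner products of length
  \<open>N div 2\<close> take \<open>N + N * (N div 2 - 1)\<close> additions, that is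
  \<open>N^2 div 2\<close>. A leading coefficient 1 or -1 saves one multiplication in each
  row.\<close>

lemma computable_with_reversal_rows:
  assumes W: "reversal_rows N W e" and N: "even N" "2 \<le> N"
  shows "computable_with N (\<lambda>x. W *\<^sub>v x) (N^2 div 2) (N^2 div 2)"
    and "(\<And>i. i < N \<Longrightarrow> W $$ (i, 0) \<in> {1, -1}) \<Longrightarrow>
      computable_with N (\<lambda>x. W *\<^sub>v x) (N^2 div 2 - N) (N^2 div 2)"
proof -
  let ?m = "N div 2"
  define h where "h i = (\<lambda>x. \<Sum>k<?m. W $$ (i, k) * butterfly N (e i) k x)" for i
  have m: "0 < ?m" using N by auto
  have Nm: "N + N * (?m - 1) = N^2 div 2" "N * ?m = N^2 div 2"
    "N * (?m - 1) = N^2 div 2 - N"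
    using N by (auto simp: power2_eq_square algebra_simps elim!: evenE)
  have sub: "butterfly N (e i) ` {..<?m} \<subseteq> G" if "i < N" "butterflies N \<subseteq> G" for i G
    using that W butterfly_in_butterflies by (auto simp: reversal_rows_def)
  \<comment> \<open>Here \<open>m'\<close> is the number of multiplications per row:
    \<open>N div 2\<close> in general, one less for normalized rows.\<close>
  have *: "computable_with N (\<lambda>x. W *\<^sub>v x) (N * m') (N^2 div 2)"
    if "\<And>i G a b. i < N \<Longrightarrow> butterflies N \<subseteq> G \<Longrightarrow> slp_reaches N G a b \<Longrightarrow>
      slp_reaches N (insert (h i) G) (a + m') (b + (?m - 1))" for m'
  proof (rule computable_with_if_slp_reaches)
    show "slp_reaches N (butterflies N \<union> h ` {..<N}) (N * m') (N^2 div 2)"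
      using slp_reaches_family[OF slp_reaches_butterflies[OF \<open>even N\<close>], of "{..<N}" h m' "?m - 1"]
        that Nm(1) by simp
    show "W *\<^sub>v x \<in> carrier_vec N" for x
      using W by (auto simp: reversal_rows_def intro!: carrier_vecI)
    show "\<exists>g\<in>butterflies N \<union> h ` {..<N}. \<forall>x\<in>carrier_vec N. g x = (W *\<^sub>v x) $ i" if "i < N" for i
      using reversal_rows_mult_vec[OF W \<open>even N\<close> that] that by (auto simp: h_def)
  qed
  show "computable_with N (\<lambda>x. W *\<^sub>v x) (N^2 div 2) (N^2 div 2)"
    using *[of ?m] slp_reaches_dot(1)[OF _ sub m] by (simp add: h_def Nm)
  show "computable_with N (\<lambda>x. W *\<^sub>v x) (N^2 div 2 - N) (N^2 div 2)"
    if "\<And>i. i < N \<Longrightarrow> W $$ (i, 0) \<in> {1, -1}"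
    unfolding Nm(3)[symmetric]
    by (rule *, unfold h_def, rule slp_reaches_dot(2)[OF _ sub m]) (use that in auto)
qed

lemma scaled_computable_with_reversal_rows:
  assumes W: "reversal_rows N W e" and N: "even N" "2 \<le> N"
    and W0: "\<And>i. i < N \<Longrightarrow> W $$ (i, 0) \<noteq> 0"
  shows "\<exists>E. pos_diag_mat N E \<and>
    computable_with N (\<lambda>x. (E * W) *\<^sub>v x) (N^2 div 2 - N) (N^2 div 2)"
proof -
  \<comment> \<open>Dividing by the modulus keeps \<open>E\<close> positive and turns the leading
    entry of each row into its sign. The reversal signs \<open>e\<close> are unchanged.\<close>
  define E where "E = mat N N (\<lambda>(i, j). if i = j then 1 / \<bar>W $$ (i, 0)\<bar> else 0)"
  have WN: "W \<in> carrier_mat N N" using W by (simp add: reversal_rows_def)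
  have EW: "(E * W) $$ (i, k) = W $$ (i, k) / \<bar>W $$ (i, 0)\<bar>" if "i < N" "k < N" for i k
  proof -
    have "(E * W) $$ (i, k) = (\<Sum>j<N. (if i = j then 1 / \<bar>W $$ (i, 0)\<bar> else 0) * W $$ (j, k))"
      using that WN by (simp add: E_def scalar_prod_def atLeast0LessThan)
    also have "\<dots> = (\<Sum>j<N. if j = i then W $$ (i, k) / \<bar>W $$ (i, 0)\<bar> else 0)"
      by (rule sum.cong) auto
    finally show ?thesis using that by simp
  qed
  have "reversal_rows N (E * W) e"
    using W EW by (auto simp: reversal_rows_def E_def)
  moreover have "(E * W) $$ (i, 0) \<in> {1, -1}" if "i < N" for i
    using EW[of i 0] W0[OF that] that N by (auto simp: abs_if)
  moreover have "pos_diag_mat N E"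
    using W0 by (auto simp: pos_diag_mat_def E_def diagonal_mat_def)
  ultimately show ?thesis using computable_with_reversal_rows(2)[OF _ N] by blast
qed

lemma is_KLT_reversal_rows:
  assumes "0 < \<rho>" "\<rho> < 1" and W: "is_KLT N \<rho> W"
  shows "\<exists>e. reversal_rows N W e" and "\<And>i. i < N \<Longrightarrow> W $$ (i, 0) \<noteq> 0"
proof -
  obtain ev where ev: "\<And>i. i < N \<Longrightarrow> eigenvector (ar1_cov N \<rho>) (row W i) (ev i)"
    and WN: "W \<in> carrier_mat N N"
    using W by (auto simp: is_KLT_def)
  note rev = ar1_eigenvector_reversal[OF assms(1,2) ev]
  show "W $$ (i, 0) \<noteq> 0" if "i < N" for i
    using rev(1)[OF that] that WN by auto
  have "\<exists>e\<in>{1, -1}. \<forall>k<N. W $$ (i, N - 1 - k) = e * W $$ (i, k)" if "i < N" for i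
    using rev(2)[OF that] that WN by auto
  then have "\<exists>e. \<forall>i<N. e i \<in> {1, -1} \<and> (\<forall>k<N. W $$ (i, N - 1 - k) = e i * W $$ (i, k))"
    by metis
  then show "\<exists>e. reversal_rows N W e"
    using WN by (auto simp: reversal_rows_def)
qed

section \<open>Order four\<close>

text \<open>Both sides compute the trace of index reversal. In the orthonormal basis of rows it is
  the sum of the signs; in the standard basis it is 0, since reversal fixes no index when
  \<open>N\<close> is even.\<close>

lemma reversal_signs_sum:
  assumes W: "reversal_rows N W e" and orth: "W * W\<^sup>T = 1\<^sub>m N" and "even N"
  shows "(\<Sum>i<N. e i) = 0"
proof -
  have WN: "W \<in> carrier_mat N N" using W by (simp add: reversal_rows_def)
  have orth': "W\<^sup>T * W = 1\<^sub>m N"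
    using mat_mult_left_right_inverse[OF WN _ orth] WN by simp
  have norm: "(\<Sum>k<N. W $$ (i, k) * W $$ (i, k)) = 1" if "i < N" for i
    using arg_cong[OF orth, of "\<lambda>A. A $$ (i, i)"] that WN
    by (simp add: scalar_prod_def atLeast0LessThan)
  have cols: "(\<Sum>i<N. W $$ (i, k) * W $$ (i, N - 1 - k)) = 0" if "k < N" for k
  proof -
    have "k \<noteq> N - 1 - k" using that \<open>even N\<close> by presburger
    then show ?thesis
      using arg_cong[OF orth', of "\<lambda>A. A $$ (k, N - 1 - k)"] that WN
      by (simp add: scalar_prod_def atLeast0LessThan)
  qed
  \<comment> \<open>Each sign is the inner product of a unit row with its reversal. Swapping the
    sums then produces inner products of distinct columns.\<close>
  have "(\<Sum>i<N. e i) = (\<Sum>i<N. \<Sum>k<N. W $$ (i, k) * W $$ (i, N - 1 - k))"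
  proof (rule sum.cong[OF refl])
    fix i assume "i \<in> {..<N}"
    then have "e i = e i * (\<Sum>k<N. W $$ (i, k) * W $$ (i, k))" using norm by simp
    also have "\<dots> = (\<Sum>k<N. W $$ (i, k) * W $$ (i, N - 1 - k))"
      unfolding sum_distrib_left using W \<open>i \<in> {..<N}\<close>
      by (intro sum.cong) (auto simp: reversal_rows_def)
    finally show "e i = (\<Sum>k<N. W $$ (i, k) * W $$ (i, N - 1 - k))" .
  qed
  also have "\<dots> = (\<Sum>k<N. \<Sum>i<N. W $$ (i, k) * W $$ (i, N - 1 - k))" by (rule sum.swap)
  finally show ?thesis using cols by simp
qed

text \<open>In the plane, a vector orthogonal to \<open>(a, b)\<close> and of the same length is a
  quarter turn of it, up to sign.\<close>

lemma orthogonal_plane_vectors: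
  fixes a b c d :: real
  assumes "a * c + b * d = 0" and "a^2 + b^2 = c^2 + d^2"
  shows "\<exists>s\<in>{1, -1}. c = s * (- b) \<and> d = s * a"
proof (cases "a^2 + b^2 = 0")
  case True
  then have "a = 0" "b = 0" "c = 0" "d = 0"
    using assms(2) sum_power2_eq_zero_iff by metis+
  then show ?thesis by (intro bexI[of _ 1]) auto
next
  case False
  \<comment> \<open>The right-hand side lies in the ideal generated by the two assumptions, so it
    vanishes.\<close>
  have "(a^2 + b^2) * (c^2 - b^2) = (a * c + b * d) * (a * c - b * d) + b^2 * (c^2 + d^2 - (a^2 + b^2))"
    by (simp add: algebra_simps power2_eq_square)
  then have "(a^2 + b^2) * (c^2 - b^2) = 0" unfolding assms by simp
  then have "c^2 = b^2" using False by (simp only: mult_eq_0_iff eq_iff_diff_eq_0[symmetric] simp_thms)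
  then have "d^2 = a^2" using assms(2) by simp
  from \<open>c^2 = b^2\<close> \<open>d^2 = a^2\<close> have "c = b \<or> c = - b" "d = a \<or> d = - a"
    by (simp_all add: power2_eq_iff)
  \<comment> \<open>The choices \<open>c = b, d = a\<close> and \<open>c = - b, d = - a\<close>
    force \<open>a * b = 0\<close>; then one coordinate is zero and its sign is free.\<close>
  then show ?thesis using assms(1) by (auto simp: algebra_simps)
qed

text \<open>Up to the free sign \<open>s\<close>, the two outputs are the real and imaginary parts
  of the complex product \<open>(a - i b)(u + i v)\<close>. The classical scheme for multiplying by
  a complex constant needs three real multiplications and three additions, as \<open>b - a\<close>
  and \<open>a + b\<close> are precomputed.\<close>

lemma slp_reaches_orthogonal_pair:
  assumes "slp_reaches N F A B" and u: "u \<in> F" and v: "v \<in> F"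
    and "a * c + b * d = 0" and "a^2 + b^2 = c^2 + d^2"
  shows "slp_reaches N (insert (\<lambda>x. a * u x + b * v x) (insert (\<lambda>x. c * u x + d * v x) F))
    (A + 3) (B + 3)"
proof -
  obtain s where s: "s \<in> {1, -1}" "c = s * (- b)" "d = s * a"
    using orthogonal_plane_vectors[OF assms(4,5)] by blast
  text \<open>With \<open>t = a (u + v)\<close> one has \<open>a u + b v = t + (b - a) v\<close> and
    \<open>- b u + a v = t - (a + b) u\<close>.\<close>
  define p where "p = (\<lambda>x. u x + v x)"
  define t where "t = (\<lambda>x. a * p x)"
  define q where "q = (\<lambda>x. (b - a) * v x)"
  define r where "r = (\<lambda>x. (a + b) * u x)"
  define y where "y = (\<lambda>x. t x + q x)"
  define z where "z = (\<lambda>x. t x - r x)"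
  have "slp_reaches N (insert p F) A (Suc B)"
    unfolding p_def by (rule slp_reaches_add[OF assms(1) u v])
  then have "slp_reaches N (insert t (insert p F)) (Suc A) (Suc B)"
    unfolding t_def by (rule slp_reaches_scale) auto
  then have "slp_reaches N (insert q (insert t (insert p F))) (Suc (Suc A)) (Suc B)"
    unfolding q_def by (rule slp_reaches_scale) (use v in auto)
  then have "slp_reaches N (insert r (insert q (insert t (insert p F)))) (Suc (Suc (Suc A))) (Suc B)"
    unfolding r_def by (rule slp_reaches_scale) (use u in auto)
  then have "slp_reaches N (insert y (insert r (insert q (insert t (insert p F)))))
      (Suc (Suc (Suc A))) (Suc (Suc B))"
    unfolding y_def by (rule slp_reaches_add) auto
  then have "slp_reaches N (insert z (insert y (insert r (insert q (insert t (insert p F))))))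
      (Suc (Suc (Suc A))) (Suc (Suc (Suc B)))"
    unfolding z_def by (rule slp_reaches_sub) auto
  then have "slp_reaches N (insert (\<lambda>x. s * z x) (insert z (insert y (insert r (insert q (insert t (insert p F)))))))
      (Suc (Suc (Suc A))) (Suc (Suc (Suc B)))"
    by (rule slp_reaches_sign) (use s in auto)
  moreover have "y = (\<lambda>x. a * u x + b * v x)"
    by (simp add: y_def t_def q_def p_def fun_eq_iff algebra_simps)
  moreover have "(\<lambda>x. s * z x) = (\<lambda>x. c * u x + d * v x)"
    by (simp add: z_def t_def r_def p_def s fun_eq_iff algebra_simps)
  ultimately show ?thesis by (auto elim!: slp_reaches_mono)
qed

lemma four_signs_split:
  fixes e :: "nat \<Rightarrow> real"
  assumes "\<And>i. i < 4 \<Longrightarrow> e i \<in> {1, -1}" and "(\<Sum>i<4. e i) = 0"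
  obtains i j k l where "{i, j, k, l} = {..<4}" "i \<noteq> j" "k \<noteq> l"
    "e i = 1" "e j = 1" "e k = -1" "e l = -1"
proof -
  have s: "e 0 + e 1 + e 2 + e 3 = 0"
    using assms(2) by (simp add: eval_nat_numeral)
  have set4: "{..<4::nat} = {0, 1, 2, 3}" by auto
  have "e 0 = 1 \<or> e 0 = -1" "e 1 = 1 \<or> e 1 = -1" "e 2 = 1 \<or> e 2 = -1" "e 3 = 1 \<or> e 3 = -1"
    using assms(1)[of 0] assms(1)[of 1] assms(1)[of 2] assms(1)[of 3] by auto
  \<comment> \<open>The six cases are the choices of the two indices with sign 1.\<close>
  then consider
    "e 0 = 1" "e 1 = 1" "e 2 = -1" "e 3 = -1" | "e 0 = 1" "e 2 = 1" "e 1 = -1" "e 3 = -1" |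
    "e 0 = 1" "e 3 = 1" "e 1 = -1" "e 2 = -1" | "e 1 = 1" "e 2 = 1" "e 0 = -1" "e 3 = -1" |
    "e 1 = 1" "e 3 = 1" "e 0 = -1" "e 2 = -1" | "e 2 = 1" "e 3 = 1" "e 0 = -1" "e 1 = -1"
    using s by (elim disjE) simp_all
  then show thesis
  proof cases
    case 1 then show thesis by (intro that[of 0 1 2 3]) (auto simp: set4)
  next
    case 2 then show thesis by (intro that[of 0 2 1 3]) (auto simp: set4)
  next
    case 3 then show thesis by (intro that[of 0 3 1 2]) (auto simp: set4)
  next
    case 4 then show thesis by (intro that[of 1 2 0 3]) (auto simp: set4)
  next
    case 5 then show thesis by (intro that[of 1 3 0 2]) (auto simp: set4)
  next
    case 6 then show thesis by (intro that[of 2 3 0 1]) (auto simp: set4)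
  qed
qed

text \<open>Four additions give the butterflies. Each of the two pairs of rows with equal sign then
  costs three multiplications and three additions.\<close>

lemma computable_with_reversal_rows_4:
  assumes W: "reversal_rows 4 W e" and orth: "W * W\<^sup>T = 1\<^sub>m 4"
  shows "computable_with 4 (\<lambda>x. W *\<^sub>v x) 6 10"
proof -
  have W4: "W \<in> carrier_mat 4 4" and e: "\<And>i. i < 4 \<Longrightarrow> e i \<in> {1, -1}"
    using W by (auto simp: reversal_rows_def)
  \<comment> \<open>For rows of equal sign both halves contribute the same to the inner product,
    hence the factor 2: the half rows are orthogonal and have squared length 1/2.\<close>
  have inner: "2 * (W $$ (i, 0) * W $$ (j, 0) + W $$ (i, 1) * W $$ (j, 1)) = (if i = j then 1 else 0)"
    if "i < 4" "j < 4" "e i = e j" for i j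
  proof -
    have "(\<Sum>k<4. W $$ (i, k) * W $$ (j, k)) = (if i = j then 1 else 0)"
      using arg_cong[OF orth, of "\<lambda>A. A $$ (i, j)"] that W4
      by (simp add: scalar_prod_def atLeast0LessThan)
    also have "(\<Sum>k<4. W $$ (i, k) * W $$ (j, k)) =
        (\<Sum>k<2. W $$ (i, k) * W $$ (j, k) + W $$ (i, 3 - k) * W $$ (j, 3 - k))"
      using sum_fold_even[of 4 "\<lambda>k. W $$ (i, k) * W $$ (j, k)"] by simp
    also have "\<dots> = (\<Sum>k<2. 2 * (W $$ (i, k) * W $$ (j, k)))"
    proof (rule sum.cong[OF refl])
      fix k :: nat assume "k \<in> {..<2}"
      then have "W $$ (i, 3 - k) = e i * W $$ (i, k)" "W $$ (j, 3 - k) = e i * W $$ (j, k)"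
        using W that by (auto simp: reversal_rows_def)
      then have "W $$ (i, 3 - k) * W $$ (j, 3 - k) = (e i * e i) * (W $$ (i, k) * W $$ (j, k))"
        by (simp only: mult_ac)
      moreover have "e i * e i = 1" using e[OF \<open>i < 4\<close>] by auto
      ultimately show "W $$ (i, k) * W $$ (j, k) + W $$ (i, 3 - k) * W $$ (j, 3 - k) =
          2 * (W $$ (i, k) * W $$ (j, k))" by simp
    qed
    finally show ?thesis by (simp add: eval_nat_numeral algebra_simps)
  qed
  define h where "h i = (\<lambda>x. W $$ (i, 0) * butterfly 4 (e i) 0 x + W $$ (i, 1) * butterfly 4 (e i) 1 x)" for i
  have pair: "slp_reaches 4 (insert (h i) (insert (h j) G)) (a + 3) (b + 3)"
    if ij: "i < 4" "j < 4" "i \<noteq> j" "e i = e j" and G: "butterflies 4 \<subseteq> G" "slp_reaches 4 G a b"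
    for i j G a b
  proof -
    have "butterfly 4 (e i) 0 \<in> G" "butterfly 4 (e i) 1 \<in> G"
      using G(1) butterfly_in_butterflies[OF e[OF ij(1)], of _ 4] by auto
    then show ?thesis
      unfolding h_def ij(4)[symmetric]
      using inner[OF ij(1,2,4)] inner[OF ij(1,1)] inner[OF ij(2,2)] ij(3)
      by (intro slp_reaches_orthogonal_pair[OF G(2)]) (auto simp: power2_eq_square)
  qed
  obtain i j k l where ijkl: "{i, j, k, l} = {..<4}" "i \<noteq> j" "k \<noteq> l"
    "e i = 1" "e j = 1" "e k = -1" "e l = -1"
    by (rule four_signs_split[of e, OF e reversal_signs_sum[OF W orth]]) auto
  then have lt: "i < 4" "j < 4" "k < 4" "l < 4" by auto
  have "slp_reaches 4 (insert (h i) (insert (h j) (butterflies 4))) (0 + 3) (4 + 3)"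
    by (rule pair[OF _ _ _ _ _ slp_reaches_butterflies]) (use ijkl lt in auto)
  from pair[OF lt(3,4) _ _ _ this] have "slp_reaches 4 (insert (h k) (insert (h l) (insert (h i) (insert (h j) (butterflies 4)))))
      (0 + 3 + 3) (4 + 3 + 3)"
    using ijkl by auto
  then have "slp_reaches 4 (h ` {..<4}) 6 10"
    unfolding ijkl(1)[symmetric] by (auto elim!: slp_reaches_mono)
  then show ?thesis
  proof (rule computable_with_if_slp_reaches)
    show "W *\<^sub>v x \<in> carrier_vec 4" for x using W4 by (auto intro!: carrier_vecI)
    have "(\<Sum>k<2. g k) = g 0 + g 1" for g :: "nat \<Rightarrow> real" by (simp add: numeral_2_eq_2)
    then show "\<exists>g\<in>h ` {..<4}. \<forall>x\<in>carrier_vec 4. g x = (W *\<^sub>v x) $ i" if "i < 4" for i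
      using reversal_rows_mult_vec[OF W _ that] that by (auto simp: h_def)
  qed
qed

section \<open>Operation counts for the Karhunen--Loeve transform\<close>

theorem mainTheorem5:
  fixes \<rho> :: real
  assumes "0 < \<rho>" and "\<rho> < 1"
  shows "(\<forall>N W. 2 \<le> N \<longrightarrow> even N \<longrightarrow> is_KLT N \<rho> W \<longrightarrow>
            computable_with N (\<lambda>x. W *\<^sub>v x) (N^2 div 2) (N^2 div 2) \<and>
            (\<exists>E. pos_diag_mat N E \<and>
               computable_with_mults N (\<lambda>x. (E * W) *\<^sub>v x) (N^2 div 2 - N)))
       \<and> (\<forall>W. is_KLT 8 \<rho> W \<longrightarrow>
            computable_with 8 (\<lambda>x. W *\<^sub>v x) 32 32 \<and>
            (\<exists>E. pos_diag_mat 8 E \<and>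
               computable_with 8 (\<lambda>x. (E * W) *\<^sub>v x) 24 32))
       \<and> (\<forall>W. is_KLT 4 \<rho> W \<longrightarrow>
            computable_with 4 (\<lambda>x. W *\<^sub>v x) 6 10 \<and>
            (\<exists>E. pos_diag_mat 4 E \<and>
               computable_with 4 (\<lambda>x. (E * W) *\<^sub>v x) 4 8))"
proof -
  have *: "computable_with N (\<lambda>x. W *\<^sub>v x) (N^2 div 2) (N^2 div 2)"
    "\<exists>E. pos_diag_mat N E \<and> computable_with N (\<lambda>x. (E * W) *\<^sub>v x) (N^2 div 2 - N) (N^2 div 2)"
    if N: "even N" "2 \<le> N" and W: "is_KLT N \<rho> W" for N W
  proof -
    obtain e where e: "reversal_rows N W e" using is_KLT_reversal_rows(1)[OF assms W] by blast
    show "computable_with N (\<lambda>x. W *\<^sub>v x) (N^2 div 2) (N^2 div 2)"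
      by (rule computable_with_reversal_rows(1)[OF e N])
    show "\<exists>E. pos_diag_mat N E \<and> computable_with N (\<lambda>x. (E * W) *\<^sub>v x) (N^2 div 2 - N) (N^2 div 2)"
      by (rule scaled_computable_with_reversal_rows[OF e N is_KLT_reversal_rows(2)[OF assms W]])
  qed
  have mults: "computable_with_mults N f a" if "computable_with N f a b" for N f a b
    using that unfolding computable_with_def computable_with_mults_def by blast
  have four: "computable_with 4 (\<lambda>x. W *\<^sub>v x) 6 10" if W: "is_KLT 4 \<rho> W" for W
    using is_KLT_reversal_rows(1)[OF assms W] computable_with_reversal_rows_4 W
    by (auto simp: is_KLT_def)
  show ?thesis
  proof (intro conjI allI impI)
    fix N :: nat and W assume "2 \<le> N" "even N" "is_KLT N \<rho> W"
    note KLT = *[OF this(2,1,3)]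
    show "computable_with N (\<lambda>x. W *\<^sub>v x) (N^2 div 2) (N^2 div 2)" by (rule KLT(1))
    show "\<exists>E. pos_diag_mat N E \<and> computable_with_mults N (\<lambda>x. (E * W) *\<^sub>v x) (N^2 div 2 - N)"
      using KLT(2) by (elim ex_forward conj_forward) (auto intro: mults)
  next
    fix W assume "is_KLT 8 \<rho> W"
    then show "computable_with 8 (\<lambda>x. W *\<^sub>v x) 32 32"
      "\<exists>E. pos_diag_mat 8 E \<and> computable_with 8 (\<lambda>x. (E * W) *\<^sub>v x) 24 32"
      using *[of 8 W] by simp_all
  next
    fix W assume W: "is_KLT 4 \<rho> W"
    show "computable_with 4 (\<lambda>x. W *\<^sub>v x) 6 10" by (rule four[OF W])
    \<comment> \<open>The general scaled count already gives \<open>16 div 2 - 4 = 4\<close> and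
      \<open>16 div 2 = 8\<close>; the rotation trick serves only the unscaled transform.\<close>
    show "\<exists>E. pos_diag_mat 4 E \<and> computable_with 4 (\<lambda>x. (E * W) *\<^sub>v x) 4 8"
      using *(2)[of 4 W] W by simp
  qed
qed

end
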